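(* Let $k\ge 0$ be an integer. The morphism $h_{k+1}$ is cubefree if and only if the base-$2$ representation of $k$ (read starting with the most significant digit) is accepted by the deterministic finite automaton $\mathcal{A}$ with states $0,1,2,3$, initial state $0$, set of accepting states $\{0,1\}$, and transition function $\delta$ given by $$\delta(0,0)=0,\quad \delta(0,1)=1,\quad \delta(1,0)=2,\quad \delta(1,1)=1,\quad \delta(2,0)=1,\quad \delta(2,1)=3,\quad \delta(3,0)=2,\quad \delta(3,1)=3,$$ where $\delta(q,d)$ denotes the state reached from state $q$ on reading the digit $d$.
   Context: Words are finite or (one-sided) infinite, over $\{0,1\}$, indexed from $0$; $w[i..j]=w[i]w[i+1]\cdots w[j]$. A factor is a contiguous sub-block. The complement $\overline{w}$ of a binary word $w$ is obtained by exchanging $0$ and $1$ letterwise. For a finite nonempty word $w$ of length $n$, an integer $p$ with $1\le p\le n$ is a period of $w$ if $w[i]=w[i+p]$ for $0\le i<n-p$; $\mathrm{per}(w)$ is the smallest period, and $\exp(w)=n/\mathrm{per}(w)$. The critical exponent $\mathrm{cexp}(w)$ of a finite or infinite word is the supremum of $\exp(x)$ over all finite nonempty factors $x$ of $w$. A word $w$ is cubefree if $\mathrm{cexp}(w)<3$. A morphism $h$ is cubefree if for all words $w$: $w$ cubefree implies $h(w)$ cubefree. The Thue--Morse word $\mathbf{t}=0110100110010110\cdots$ is the infinite fixed point starting with $0$ of the morphism $\mu:0\mapsto 01,\ 1\mapsto 10$. For an integer $k\ge1$, $h_k$ is the morphism on $\{0,1\}$ with $h_k(0)=\mathbf{t}[0..k-1]$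 and $h_k(1)=\overline{\mathbf{t}[0..k-1]}$. *)

theory Defs
  imports Complex_Main "HOL-Library.Extended_Real" "HOL-Library.Stream" "HOL-Library.Sublist"
begin

section \<open>Words, exponents, and cubefreeness\<close>

datatype 'a word = Fin "'a list" | Inf "'a stream"

fun factors :: "'a word \<Rightarrow> 'a list set" where
  "factors (Fin w) = {x. sublist x w}"
| "factors (Inf s) = {stake n (sdrop i s) | i n. True}"

definition is_period :: "'a list \<Rightarrow> nat \<Rightarrow> bool" where
  "is_period w p \<longleftrightarrow> 1 \<le> p \<and> p \<le> length w \<and> (\<forall>i < length w - p. w ! i = w ! (i + p))"

text \<open>\<open>per\<close> and \<open>expo\<close> are meaningful for nonempty words only; a nonempty
  word always has its own length as a period.\<close>

definition per :: "'a list \<Rightarrow> nat" where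
  "per w = (LEAST p. is_period w p)"

definition expo :: "'a list \<Rightarrow> real" where
  "expo w = real (length w) / real (per w)"

text \<open>The supremum is taken in the extended reals: it may be infinite for infinite words, and it
  is \<open>-\<infinity>\<close> for the empty word, which is thus cubefree.\<close>

definition cexp :: "'a word \<Rightarrow> ereal" where
  "cexp w = (SUP x \<in> {x \<in> factors w. x \<noteq> []}. ereal (expo x))"

definition cubefree :: "'a word \<Rightarrow> bool" where
  "cubefree w \<longleftrightarrow> cexp w < 3"


section \<open>Morphisms\<close>

text \<open>A morphism is given by the images of the letters. The clause for infinite words is correct for
  nonerasing morphisms, i.e. when all these images are nonempty; all morphisms used
  below are of this kind.\<close>

fun apply_morphism :: "('a \<Rightarrow> 'b list) \<Rightarrow> 'a word \<Rightarrow> 'b word" where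
  "apply_morphism f (Fin w) = Fin (concat (map f w))"
| "apply_morphism f (Inf s) = Inf (flat (smap f s))"

definition cubefree_morphism :: "('a \<Rightarrow> 'b list) \<Rightarrow> bool" where
  "cubefree_morphism f \<longleftrightarrow> (\<forall>w. cubefree w \<longrightarrow> cubefree (apply_morphism f w))"


section \<open>The Thue--Morse word\<close>

text \<open>Binary letters and digits are Booleans: \<^const>\<open>False\<close> stands for 0 and \<^const>\<open>True\<close> for 1.
  The complement of a letter is its negation.\<close>

fun mu :: "bool \<Rightarrow> bool list" where
  "mu False = [False, True]"
| "mu True = [True, False]"

definition thue_morse :: "bool stream" where
  "thue_morse = (THE s. apply_morphism mu (Inf s) = Inf s \<and> shd s = False)"

definition complement :: "bool list \<Rightarrow> bool list" where
  "complement w = map Not w"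

definition h :: "nat \<Rightarrow> bool \<Rightarrow> bool list" where
  "h k c = (if c then complement (stake k thue_morse) else stake k thue_morse)"

text \<open>The description of \<^const>\<open>thue_morse\<close> is proper.\<close>

lemma mu_eq: "mu c = [c, \<not> c]"
  by (cases c) simp_all

lemma stream_eqI: "s = s'" if "\<And>n. s !! n = s' !! n"
  using that smap_alt[of "\<lambda>x. x" s s'] by (simp add: stream.map_ident)

lemma flat_mu_snth:
  "flat (smap mu s) !! (2 * n) = s !! n"
  "flat (smap mu s) !! Suc (2 * n) = (\<not> s !! n)"
proof (induction n arbitrary: s)
  case 0
  { case 1 show ?case by (cases s) (simp add: mu_eq) }
  { case 2 show ?case by (cases s) (simp add: mu_eq) }
next
  case (Suc n)
  { case 1 show ?case using Suc(1)[of "stl s"] by (cases s) (simp add: mu_eq) }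
  { case 2 show ?case using Suc(2)[of "stl s"] by (cases s) (simp add: mu_eq) }
qed

lemma mu_fixed_iff:
  "flat (smap mu s) = s \<longleftrightarrow> (\<forall>n. s !! (2 * n) = s !! n \<and> s !! Suc (2 * n) = (\<not> s !! n))"
proof
  assume "flat (smap mu s) = s"
  then show "\<forall>n. s !! (2 * n) = s !! n \<and> s !! Suc (2 * n) = (\<not> s !! n)"
    using flat_mu_snth[of s] by simp
next
  assume *: "\<forall>n. s !! (2 * n) = s !! n \<and> s !! Suc (2 * n) = (\<not> s !! n)"
  have "flat (smap mu s) !! m = s !! m" for m
  proof (cases "even m")
    case True
    then obtain n where "m = 2 * n" by (elim evenE)
    then show ?thesis using * flat_mu_snth(1)[of s n] by metis
  next
    case False
    then obtain n where "m = Suc (2 * n)" by (elim oddE) simp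
    then show ?thesis using * flat_mu_snth(2)[of s n] by metis
  qed
  then show "flat (smap mu s) = s" by (rule stream_eqI)
qed

fun bit_parity :: "nat \<Rightarrow> bool" where
  "bit_parity n = (if n = 0 then False else bit_parity (n div 2) \<noteq> odd n)"

declare bit_parity.simps [simp del]

lemma thue_morse_ex1: "\<exists>!s. apply_morphism mu (Inf s) = Inf s \<and> shd s = False"
proof (rule ex1I)
  let ?s = "smap bit_parity nats"
  have "bit_parity (2 * n) = bit_parity n" for n
    by (cases "n = 0") (simp_all add: bit_parity.simps[of "2 * n"] bit_parity.simps[of 0])
  moreover have "bit_parity (Suc (2 * n)) = (\<not> bit_parity n)" for n
    by (simp add: bit_parity.simps[of "Suc (2 * n)"])
  ultimately have "flat (smap mu ?s) = ?s"
    unfolding mu_fixed_iff by simp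
  moreover have "shd ?s = False" by (simp add: bit_parity.simps)
  ultimately show "apply_morphism mu (Inf ?s) = Inf ?s \<and> shd ?s = False" by simp
next
  fix s assume s: "apply_morphism mu (Inf s) = Inf s \<and> shd s = False"
  then have *: "\<forall>n. s !! (2 * n) = s !! n \<and> s !! Suc (2 * n) = (\<not> s !! n)"
    by (simp add: mu_fixed_iff)
  have "s !! m = bit_parity m" for m
  proof (induction m rule: less_induct)
    case (less m)
    show ?case
    proof (cases "m = 0")
      case True
      then show ?thesis using s by (simp add: bit_parity.simps)
    next
      case False
      then have IH: "s !! (m div 2) = bit_parity (m div 2)" using less by simp
      have bp: "bit_parity m = (bit_parity (m div 2) \<noteq> odd m)"
        using False by (simp add: bit_parity.simps[of m])
      show ?thesis
      proof (cases "even m")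
        case True
        then have "2 * (m div 2) = m" by simp
        then show ?thesis using * IH bp True by metis
      next
        case False
        then have "Suc (2 * (m div 2)) = m" by simp
        then show ?thesis using * IH bp False by metis
      qed
    qed
  qed
  then show "s = smap bit_parity nats" by (intro stream_eqI) simp
qed

lemma thue_morse_fixed: "flat (smap mu thue_morse) = thue_morse"
  and thue_morse_shd: "shd thue_morse = False"
  using theI'[OF thue_morse_ex1] unfolding thue_morse_def by simp_all


section \<open>Binary representations and the automaton\<close>

text \<open>Most significant digit first. The representation of 0 is the empty word; since \<open>A_delta\<close>
  fixes the initial state on reading 0, the representation consisting of the single digit 0 would be
  accepted as well.\<close>

fun base2 :: "nat \<Rightarrow> bool list" where
  "base2 n = (if n = 0 then [] else base2 (n div 2) @ [odd n])"

declare base2.simps [simp del]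

datatype state = Q0 | Q1 | Q2 | Q3

fun A_delta :: "state \<Rightarrow> bool \<Rightarrow> state" where
  "A_delta Q0 False = Q0"
| "A_delta Q0 True = Q1"
| "A_delta Q1 False = Q2"
| "A_delta Q1 True = Q1"
| "A_delta Q2 False = Q1"
| "A_delta Q2 True = Q3"
| "A_delta Q3 False = Q2"
| "A_delta Q3 True = Q3"

definition A_accepts :: "bool list \<Rightarrow> bool" where
  "A_accepts ds \<longleftrightarrow> foldl A_delta Q0 ds \<in> {Q0, Q1}"

end

theory Submission
  imports Defs
begin

text \<open>
  Write \<open>t\<close> for the Thue--Morse word and \<open>K = k + 1\<close>. The automaton in effect strips the trailing
  ones of \<open>k\<close> and then looks at the parity of the number of trailing zeros of what is left. Both
  steps have a meaning for the morphisms; and if nothing is left, \<open>h\<^sub>1\<close> is the identity.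

  Stripping a trailing one corresponds to the factorisation \<open>h\<^bsub>2K\<^esub> = \<mu> \<circ> h\<^bsub>K\<^esub>\<close>, where \<open>\<mu> = h\<^sub>2\<close>.
  Since \<open>\<mu>\<close> is cubefree, and since a cube in \<open>x\<close> yields one in \<open>\<mu>(x)\<close>, the morphism \<open>h\<^bsub>2K\<^esub>\<close> is
  cubefree iff \<open>h\<^bsub>K\<^esub>\<close> is (\<open>cubefree_morphism_h_double\<close>).

  For even \<open>k > 0\<close> the number of trailing zeros is even iff \<open>t[k-1] \<noteq> t[k]\<close>, and this is the exact
  condition for \<open>h\<^bsub>K\<^esub>\<close> to be cubefree (\<open>cubefree_morphism_h_Suc_even\<close>). If \<open>t[k-1] = t[k] = c\<close>,
  then \<open>ccc\<close> occurs at the junction of the blocks \<open>h\<^bsub>K\<^esub>(0)\<close> and \<open>h\<^bsub>K\<^esub>(c)\<close>. For the converse,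
  consider a factor of period \<open>p\<close>, longer than \<open>p\<close>, in an image \<open>h\<^bsub>K\<^esub>(w)\<close>.

  If \<open>K\<close> divides \<open>p\<close>, this repetition comes from one in \<open>w\<close> of at least the same exponent: the two
  blocks are complementary, so that a single letter at a known position of a block determines the
  whole block, and no partial block is lost at the ends (\<open>repetition_descend\<close>).

  Suppose that \<open>K\<close> does not divide \<open>p\<close>. Whether two adjacent letters inside a block differ is
  independent of \<open>w\<close>: letters \<open>i - 1\<close> and \<open>i\<close> of a block differ when \<open>i\<close> is odd, and agree when \<open>i
  \<equiv> 2\<close> modulo 4. Shifting by \<open>p\<close> misaligns these patterns. When \<open>p > K\<close>, the image cannot agree
  with its shift by \<open>p\<close> along \<open>2K\<close> positions (\<open>long_agreement_dvd\<close>); when \<open>p < K\<close>, a cube of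
  period \<open>p\<close> is impossible (\<open>no_short_cube\<close>), by parity at the ends of the blocks and by the
  overlap-freeness of \<open>t\<close> inside them. Either way the exponent is at most \<open>3 - 1/K\<close>. This bound
  does not depend on the repetition, as the supremum in the critical exponent of an infinite word
  requires.
\<close>

section \<open>The Thue--Morse word\<close>

abbreviation tm :: "nat \<Rightarrow> bool" where
  "tm n \<equiv> thue_morse !! n"

text \<open>\<open>jump (n + 1)\<close> is letter \<open>n\<close> of the period-doubling word: for \<open>n > 0\<close>, \<open>jump n\<close> holds iff
  the number of trailing zeros in the binary representation of \<open>n\<close> is even.\<close>

definition jump :: "nat \<Rightarrow> bool" where
  "jump n \<longleftrightarrow> tm (n - 1) \<noteq> tm n"

lemma tm_0: "\<not> tm 0"
  using thue_morse_shd by simp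

lemma tm_even: "tm (2 * n) = tm n" and tm_odd: "tm (Suc (2 * n)) = (\<not> tm n)"
  using thue_morse_fixed unfolding mu_fixed_iff by blast+

lemma jump_odd:
  assumes "odd n"
  shows "jump n"
proof -
  obtain m where "n = Suc (2 * m)" using assms by (auto elim: oddE)
  then show ?thesis using tm_even[of m] tm_odd[of m] by (simp add: jump_def del: snth.simps)
qed

lemma jump_double:
  assumes "n > 0"
  shows "jump (2 * n) \<longleftrightarrow> \<not> jump n"
proof -
  have "2 * n - 1 = Suc (2 * (n - 1))" using assms by simp
  then show ?thesis unfolding jump_def by (simp only: tm_even tm_odd) blast
qed

text \<open>This fact and \<open>jump_odd\<close> are almost all that is needed to refute a misaligned agreement of
  two pieces of the Thue--Morse word.\<close>

lemma not_jump_2_mod_4: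
  assumes "n mod 4 = 2"
  shows "\<not> jump n"
proof -
  have "odd (n div 2)" "n = 2 * (n div 2)" using assms by presburger+
  then show ?thesis using jump_double[of "n div 2"] jump_odd[of "n div 2"] by (metis odd_pos)
qed

lemma jump_4: "jump 4"
  using jump_double[of 2] not_jump_2_mod_4[of 2] by simp

text \<open>Under an odd shift, a position that is 2 modulo 4, where \<open>jump\<close> fails, is matched with an
  odd position, where it holds, and conversely. Modulo 4, the positions that are 2, or become 2
  after the shift, are two neighbouring residues, so one of them occurs among any three
  consecutive positions.\<close>

lemma jump_odd_shift:
  assumes "odd q"
  shows "\<exists>j\<in>{c + 1, c + 2, c + 3}. jump j \<noteq> jump (j + q)"
proof -
  have "\<exists>j\<in>{c + 1, c + 2, c + 3}. j mod 4 = 2 \<or> (j + q) mod 4 = 2"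
  proof -
    have "q mod 4 = 1 \<or> q mod 4 = 3" using assms by presburger
    then consider "c mod 4 \<noteq> 2" | "c mod 4 = 2" "q mod 4 = 1" | "c mod 4 = 2" "q mod 4 = 3"
      by blast
    then show ?thesis
    proof cases
      case 1
      then have "(c + 1) mod 4 = 2 \<or> (c + 2) mod 4 = 2 \<or> (c + 3) mod 4 = 2" by presburger
      then show ?thesis by blast
    next
      case 2
      then have "(c + 3 + q) mod 4 = 2" by presburger
      then show ?thesis by blast
    next
      case 3
      then have "(c + 1 + q) mod 4 = 2" by presburger
      then show ?thesis by blast
    qed
  qed
  then obtain j where j: "j \<in> {c + 1, c + 2, c + 3}" "j mod 4 = 2 \<or> (j + q) mod 4 = 2" by blast
  from j(2) have "jump j \<noteq> jump (j + q)"
  proof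
    assume "j mod 4 = 2"
    moreover from this have "odd (j + q)" using assms by presburger
    ultimately show ?thesis using jump_odd not_jump_2_mod_4 by blast
  next
    assume "(j + q) mod 4 = 2"
    moreover from this have "odd j" using assms by presburger
    ultimately show ?thesis using jump_odd not_jump_2_mod_4 by blast
  qed
  then show ?thesis using j(1) by blast
qed

text \<open>An agreement of length \<open>q + 1\<close> with the shift by \<open>q\<close> would be an overlap. For even \<open>q\<close> it
  can be halved, because the letters at even positions, and the negated ones at odd positions,
  spell the word again; for odd \<open>q\<close> it contradicts \<open>jump_odd_shift\<close> as soon as \<open>q \<ge> 3\<close>.\<close>

lemma tm_overlap_free:
  assumes "q > 0"
  shows "\<exists>i. c \<le> i \<and> i \<le> c + q \<and> tm i \<noteq> tm (i + q)"
  using assms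
proof (induction q arbitrary: c rule: less_induct)
  case (less q)
  show ?case
  proof (rule ccontr)
    assume "\<not> ?thesis"
    then have eq: "tm i = tm (i + q)" if "c \<le> i" "i \<le> c + q" for i using that by blast
    consider "q = 1" | "odd q" "q \<ge> 3" | "even q" using less.prems by atomize_elim presburger
    then show False
    proof cases
      case 1
      have "\<not> jump (c + 1)" "\<not> jump (c + 2)"
        using eq[of c] eq[of "c + 1"] 1 by (auto simp: jump_def)
      then show False using jump_odd[of "c + 1"] jump_odd[of "c + 2"] by auto
    next
      case 2
      obtain j where j: "j \<in> {c + 1, c + 2, c + 3}" "jump j \<noteq> jump (j + q)"
        using jump_odd_shift[OF 2(1)] by blast
      have "tm (j - 1) = tm (j - 1 + q)" "tm j = tm (j + q)"
        using j(1) 2(2) by (auto intro!: eq)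
      moreover have "j - 1 + q = j + q - 1" using j(1) by auto
      ultimately show False using j(2) by (simp add: jump_def)
    next
      case 3
      then obtain r where r: "q = 2 * r" by (elim evenE)
      have "tm i = tm (i + r)" if i: "c div 2 \<le> i" "i \<le> c div 2 + r" for i
      proof (cases "even c")
        case True
        then have "tm (2 * i) = tm (2 * i + q)" using i r by (intro eq) presburger+
        then show ?thesis using tm_even[of i] tm_even[of "i + r"] r by (simp add: algebra_simps)
      next
        case False
        then have "tm (Suc (2 * i)) = tm (Suc (2 * i) + q)" using i r by (intro eq) presburger+
        then show ?thesis using tm_odd[of i] tm_odd[of "i + r"] r by (simp add: algebra_simps)
      qed
      then show False using less.IH[of r "c div 2"] less.prems r by force
    qed
  qed
qed


section \<open>Repetitions in sequences of blocks\<close>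

text \<open>The image under \<open>h\<^bsub>K\<^esub>\<close> of the word whose letters are given by the function \<open>w\<close>. With a total
  function the combinatorics below is free of length conditions; for a finite word, the values
  outside of it never matter.\<close>

definition blocks :: "nat \<Rightarrow> (nat \<Rightarrow> bool) \<Rightarrow> nat \<Rightarrow> bool" where
  "blocks K w i \<longleftrightarrow> w (i div K) \<noteq> tm (i mod K)"

definition agrees :: "(nat \<Rightarrow> bool) \<Rightarrow> nat \<Rightarrow> nat \<Rightarrow> nat \<Rightarrow> bool" where
  "agrees x p a L \<longleftrightarrow> (\<forall>i. a \<le> i \<and> i < a + L \<longrightarrow> x i = x (i + p))"

lemma blocks_add: "K dvd M \<Longrightarrow> i < K \<Longrightarrow> blocks K w (M + i) \<longleftrightarrow> w (M div K) \<noteq> tm i"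
  by (auto simp: blocks_def elim!: dvdE)

text \<open>Complementing a block does not change where adjacent letters differ, so the letters of \<open>w\<close>
  have no influence strictly inside a block.\<close>

lemma blocks_jump:
  assumes "K dvd M" "0 < i" "i < K"
  shows "blocks K w (M + i - 1) \<noteq> blocks K w (M + i) \<longleftrightarrow> jump i"
proof -
  have "M + i - 1 = M + (i - 1)" using assms by simp
  then show ?thesis
    using blocks_add[OF assms(1,3), of w] blocks_add[OF assms(1), of "i - 1" w] assms(3)
    by (auto simp: jump_def)
qed

lemma block_split:
  assumes "(K::nat) > 0"
  obtains M r where "K dvd M" "r < K" "j = M + r"
  using assms by (metis div_mult_mod_eq dvd_triv_right mod_less_divisor)

text \<open>The tool for refuting agreements: it suffices to find a position in the range which is at
  offset \<open>i\<close> of its block and is shifted to offset \<open>i'\<close>, where \<open>jump\<close> distinguishes \<open>i\<close> and \<open>i'\<close>.\<close>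

lemma agrees_jump:
  assumes ag: "agrees (blocks K w) p a L"
    and M: "K dvd M" "0 < i" "i < K" and M': "K dvd M'" "0 < i'" "i' < K"
    and eq: "M + i + p = M' + i'" and le: "a < M + i" "M + i < a + L"
  shows "jump i \<longleftrightarrow> jump i'"
proof -
  have "blocks K w (M + i - 1) = blocks K w (M + i - 1 + p)"
    "blocks K w (M + i) = blocks K w (M + i + p)"
    using ag[unfolded agrees_def, rule_format, of "M + i - 1"]
      ag[unfolded agrees_def, rule_format, of "M + i"] le by linarith+
  moreover have "M + i - 1 + p = M' + i' - 1" using eq M(2) by simp
  ultimately show ?thesis using blocks_jump[OF M, of w] blocks_jump[OF M', of w] eq by metis
qed

text \<open>An agreement of this length covers a whole block, starting at \<open>M\<close> say. Let \<open>s\<close> be the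
  remainder of \<open>p\<close>. Offsets below \<open>K - s\<close> are shifted by \<open>s\<close>, those above it by \<open>s - K\<close>, and as
  \<open>K\<close> is odd, exactly one of these shifts is odd. Offset 2, where \<open>jump\<close> fails, is then matched
  with an odd offset, unless the part with the odd shift is too short; in that case one of the
  shifts is by 2, and offsets 2 and 4 are matched with each other.\<close>

lemma long_agreement_dvd:
  assumes K: "odd K" "K \<ge> 5" and ag: "agrees (blocks K w) p a (2 * K)"
  shows "K dvd p"
proof (rule ccontr)
  assume "\<not> K dvd p"
  moreover obtain N s where p: "K dvd N" "s < K" "p = N + s"
    using block_split[of K p] K by auto
  ultimately have s: "0 < s" by (auto intro: gr0I)
  obtain M0 r where M0: "K dvd M0" "r < K" "a = M0 + r"
    using block_split[of K a] K by auto
  define M where "M = M0 + K"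
  have M: "K dvd M" "a < M" "M + K \<le> a + 2 * K" using M0 by (auto simp: M_def)
  have same: "jump i = jump (i + s)" if "0 < i" "i + s < K" for i
    using agrees_jump[OF ag M(1) _ _ dvd_add[OF M(1) p(1)], of i "i + s"] that M p by simp
  have nxt: "jump i = jump (i + s - K)" if "K < i + s" "i < K" for i
    using agrees_jump[OF ag M(1) _ _ dvd_add[OF dvd_add[OF M(1) p(1)] dvd_refl], of i "i + s - K"]
      that M p K s by simp
  have j2: "\<not> jump 2" by (rule not_jump_2_mod_4) simp
  (* If s is odd, then K - s is even and positive, hence it is 2 or at least 4. *)
  consider "odd s" "s + 4 \<le> K" | "s + 2 = K" | "even s" "s \<ge> 4" | "s = 2"
    using s p(2) K(1) by atomize_elim presburger
  then show False
  proof cases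
    case 1
    then show False using same[of 2] jump_odd[of "2 + s"] j2 by simp
  next
    case 2
    then have "4 + s - K = 2" by simp
    then show False using nxt[of 4] 2 jump_4 j2 K by simp
  next
    case 3
    then have "K - s + 2 + s - K = 2" using p(2) by simp
    then show False using nxt[of "K - s + 2"] jump_odd[of "K - s + 2"] j2 3 K p(2) by simp
  next
    case 4
    then show False using same[of 2] jump_4 j2 K by simp
  qed
qed

text \<open>From here on \<open>K = k + 1\<close> with \<open>k\<close> even. Periods \<open>p \<le> k\<close> are shorter than a block, so an
  offset stays in its block or moves to the next one. A cube of period \<open>p\<close> is an agreement of
  length \<open>2 * p\<close> with the shift by \<open>p\<close>.\<close>

context
  fixes k :: nat and w :: "nat \<Rightarrow> bool"
  assumes k: "k > 0" "even k" "jump k"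
begin

lemma k_mod_4: "k mod 4 = 0" "k \<ge> 4" "\<not> jump (k - 2)"
proof -
  have "k mod 4 = 0 \<or> k mod 4 = 2" using k(2) by presburger
  then show *: "k mod 4 = 0" using k(3) not_jump_2_mod_4[of k] by blast
  then obtain m where m: "k = 4 * Suc m" 
    using k(1) by (metis gr0_implies_Suc mod_0_imp_dvd dvdE mult_0_right neq0_conv)
  then show "k \<ge> 4" by simp
  have "(4 * m + 2) mod 4 = 2" by presburger
  then have "(k - 2) mod 4 = 2" using m by simp
  then show "\<not> jump (k - 2)" by (rule not_jump_2_mod_4)
qed

text \<open>Of two consecutive offsets within a block one is odd, so \<open>ccc\<close> would have to meet the
  junction of two blocks. The assumption on \<open>k\<close> excludes \<open>cc\<close> just before it, and the odd offset 1
  excludes it just after it.\<close>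

lemma no_cube_1: "\<not> agrees (blocks (k + 1) w) 1 a 2"
proof
  assume ag: "agrees (blocks (k + 1) w) 1 a 2"
  let ?x = "blocks (k + 1) w"
  have eq: "?x a = ?x (a + 1)" "?x (a + 1) = ?x (a + 2)"
    using ag unfolding agrees_def by (force simp: numeral_2_eq_2)+
  obtain M i where M: "k + 1 dvd M" "i < k + 1" "a + 1 = M + i"
    using block_split[of "k + 1" "a + 1"] by auto
  have no1: "\<not> jump i" if "0 < i"
    using blocks_jump[OF M(1) that M(2), of w] M(3) eq by (metis add_diff_cancel_right')
  have no2: "\<not> jump (i + 1)" if "i < k"
  proof -
    have "M + (i + 1) - 1 = a + 1" "M + (i + 1) = a + 2" using M(3) by auto
    then show ?thesis using blocks_jump[OF M(1), of "i + 1" w] eq that by simp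
  qed
  show False
  proof (cases "even i")
    case True
    then show False using no2 no1 k jump_odd[of "i + 1"] M(2) by (cases "i = k") auto
  next
    case False
    then show False using no1 jump_odd[of i] by (auto elim: oddE)
  qed
qed

text \<open>Without a cube of a single letter, such a cube is alternating, so adjacent letters differ at
  five consecutive positions. Offsets that are 2 modulo 4 are excluded, but they are too dense:
  the distance from one to the next is 4 within a block and 5 across a junction, from \<open>k - 2\<close> to 2
  in the next block.\<close>

lemma no_cube_2: "\<not> agrees (blocks (k + 1) w) 2 a 4"
proof
  assume ag: "agrees (blocks (k + 1) w) 2 a 4"
  let ?x = "blocks (k + 1) w"
  have eq: "?x i = ?x (i + 2)" if "a \<le> i" "i < a + 4" for i
    using ag that unfolding agrees_def by simp
  have e: "?x a = ?x (a + 2)" "?x (a + 1) = ?x (a + 3)" "?x (a + 2) = ?x (a + 4)"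
    "?x (a + 3) = ?x (a + 5)"
    using eq[of a] eq[of "a + 1"] eq[of "a + 2"] eq[of "a + 3"] by (simp_all add: eval_nat_numeral)
  have "?x a \<noteq> ?x (a + 1)"
  proof
    assume "?x a = ?x (a + 1)"
    then have "?x i = ?x (i + 1)" if "a \<le> i" "i < a + 2" for i
    proof -
      have "i = a \<or> i = a + 1" using that by auto
      then show ?thesis using e \<open>?x a = ?x (a + 1)\<close> by (auto simp: eval_nat_numeral)
    qed
    then show False using no_cube_1[of a] unfolding agrees_def by blast
  qed
  then have alt: "?x (j - 1) \<noteq> ?x j" if "a + 1 \<le> j" "j \<le> a + 5" for j
  proof -
    have "j = a + 1 \<or> j = a + 2 \<or> j = a + 3 \<or> j = a + 4 \<or> j = a + 5" using that by auto
    then show ?thesis using e \<open>?x a \<noteq> ?x (a + 1)\<close>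
      by (elim disjE) (simp_all add: eval_nat_numeral)
  qed
  obtain M r where M: "k + 1 dvd M" "r < k + 1" "a + 1 = M + r"
    using block_split[of "k + 1" "a + 1"] by auto
  have bad: False if "k + 1 dvd N" "i mod 4 = 2" "i \<le> k" "a + 1 \<le> N + i" "N + i \<le> a + 5" for N i
  proof -
    have "0 < i" using that by (auto intro: gr0I)
    then show False
      using alt[OF that(4,5)] blocks_jump[OF that(1), of i w] not_jump_2_mod_4[OF that(2)] that(3)
      by simp
  qed
  consider "r \<le> 2" | "2 < r" "r + 2 \<le> k" | "k < r + 2" by linarith
  then show False
  proof cases
    case 1
    then show False using bad[OF M(1), of 2] M(3) k_mod_4 by simp
  next
    case 2
    (* the least number from r on that is 2 modulo 4 *)
    define i where "i = 4 * ((r + 1) div 4) + 2"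
    have "i mod 4 = 2" unfolding i_def by presburger
    moreover have "i \<le> k" unfolding i_def using 2 k_mod_4(1) by presburger
    moreover have "r \<le> i" "i \<le> r + 3" unfolding i_def by presburger+
    ultimately show False using bad[OF M(1), of i] M(3) by simp
  next
    case 3
    then show False using bad[OF dvd_add[OF M(1) dvd_refl], of 2] M(2,3) k_mod_4 by simp
  qed
qed

text \<open>Offsets below \<open>k + 1 - p\<close> stay in their block and undergo an odd shift, so three consecutive
  ones cannot occur in the range; nor can offset 2. What is left for the range is a window around
  the other part of the block, which is too narrow except for small \<open>p\<close>. The periods 3 and 5 need
  one further forbidden offset each. If \<open>p = k - 1\<close>, the last offset \<open>k\<close> is shifted to \<open>k - 2\<close> in
  the next block.\<close>

lemma no_cube_odd:
  assumes p: "odd p" "3 \<le> p" "p \<le> k"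
  shows "\<not> agrees (blocks (k + 1) w) p a (2 * p)"
proof
  assume ag: "agrees (blocks (k + 1) w) p a (2 * p)"
  have same: "jump i = jump (i + p)"
    if "k + 1 dvd N" "0 < i" "i + p \<le> k" "a < N + i" "N + i < a + 2 * p" for N i
    using agrees_jump[OF ag that(1) _ _ that(1), of i "i + p"] that by simp
  have nxt: "jump i = jump (i + p - k - 1)"
    if "k + 1 dvd N" "k + 1 < i + p" "i \<le> k" "a < N + i" "N + i < a + 2 * p" for N i
    using agrees_jump[OF ag that(1) _ _ dvd_add[OF that(1) dvd_refl], of i "i + p - k - 1"] that p
    by simp
  obtain M r where M: "k + 1 dvd M" "r < k + 1" "a + 1 = M + r"
    using block_split[of "k + 1" "a + 1"] by auto
  note M' = dvd_add[OF M(1) dvd_refl]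
  have j2: "\<not> jump 2" by (rule not_jump_2_mod_4) simp
  show False
  proof (cases "p + 1 = k")
    case True
    have "k + p - k - 1 = k - 2" using True by simp
    then show False using nxt[OF M(1), of k] M True p k k_mod_4 by simp
  next
    case False
    then have pk: "p + 3 \<le> k" using p k by presburger
    have at2: False if "k + 1 dvd N" "a < N + 2" "N + 2 < a + 2 * p" for N
      using same[OF that(1), of 2] that jump_odd[of "2 + p"] j2 p pk by simp
    consider "r \<le> 2" | "2 < r" "r + p + 2 \<le> k" | "k < r + p + 2" by linarith
    then show False
    proof cases
      case 1
      then show False using at2[OF M(1)] M(3) p by simp
    next
      case 2
      obtain j where j: "j \<in> {r - 1 + 1, r - 1 + 2, r - 1 + 3}" "jump j \<noteq> jump (j + p)"
        using jump_odd_shift[OF p(1)] by blast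
      then have "r \<le> j" "j \<le> r + 2" using 2(1) by auto
      then show False using same[OF M(1), of j] 2 M(3) p j(2) by linarith
    next
      case 3
      note right = 3
      consider "p = 3" | "p = 5" | "p \<ge> 7" using p by atomize_elim presburger
      then show False
      proof cases
        case 1
        then have "k + p - k - 1 = 2" by simp
        then show False using nxt[OF M(1), of k] M right 1 k j2 by simp
      next
        case 2
        have "\<not> jump 6" by (rule not_jump_2_mod_4) simp
        then show False using same[OF M', of 1] M right 2 pk jump_odd[of 1] by simp
      next
        case 3
        then show False using at2[OF M'] M right by simp
      qed
    qed
  qed
qed

text \<open>Here the offsets that move to the next block undergo an odd shift. Two of them are
  forbidden: \<open>k - 2\<close>, which moves to \<open>p - 3\<close>, and \<open>k + 3 - p\<close>, which moves to 2. Hence the cube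
  cannot leave the block starting at \<open>M\<close> by more than three positions on the left and two on the
  right. Overlap-freeness of the Thue--Morse word bounds the part inside the block, which leaves
  only \<open>p = 4\<close> and \<open>k = 4\<close>; then the block is too short for the cube.\<close>

lemma no_cube_even:
  assumes p: "even p" "4 \<le> p" "p \<le> k"
  shows "\<not> agrees (blocks (k + 1) w) p a (2 * p)"
proof
  assume ag: "agrees (blocks (k + 1) w) p a (2 * p)"
  have nxt: "jump i = jump (i + p - k - 1)"
    if "k + 1 dvd N" "k + 1 < i + p" "i \<le> k" "a < N + i" "N + i < a + 2 * p" for N i
    using agrees_jump[OF ag that(1) _ _ dvd_add[OF that(1) dvd_refl], of i "i + p - k - 1"] that p
    by simp
  have bad1: False if "k + 1 dvd N" "a + 2 < N + k" "N + k < a + 2 * p + 2" for N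
  proof -
    have "jump (p - 3)" using p by (intro jump_odd) simp
    moreover have "k - 2 + p - k - 1 = p - 3" using p k_mod_4(2) by linarith
    moreover have "jump (k - 2) = jump (k - 2 + p - k - 1)"
      by (rule nxt[OF that(1)]) (use that p k_mod_4(2) in linarith)+
    ultimately show False using k_mod_4(3) by metis
  qed
  have bad2: False if "k + 1 dvd N" "a + p < N + k + 3" "N + k + 3 < a + 3 * p" for N
  proof -
    have "\<not> jump 2" by (rule not_jump_2_mod_4) simp
    moreover have "jump (k + 3 - p)" using p k by (intro jump_odd) simp
    moreover have "k + 3 - p + p - k - 1 = 2" using p by simp
    moreover have "jump (k + 3 - p) = jump (k + 3 - p + p - k - 1)"
      by (rule nxt[OF that(1)]) (use that p in linarith)+
    ultimately show False by metis
  qed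
  obtain M r where M: "k + 1 dvd M" "r < k + 1" "a + 3 = M + r"
    using block_split[of "k + 1" "a + 3"] by auto
  have up: "a + 3 * p \<le> M + k + 3"
  proof (rule ccontr)
    assume *: "\<not> ?thesis"
    then have "M + k + 3 \<le> a + p" using bad2[OF M(1)] by (meson not_le)
    then show False using bad1[OF M(1)] M p by simp
  qed
  (* the positions that stay in the block M, before and after the shift *)
  define lo hi where "lo = max a M" and "hi = min (a + 2 * p) (M + k + 1 - p)"
  have "\<not> lo + p < hi"
  proof
    assume lt: "lo + p < hi"
    obtain i where i: "lo - M \<le> i" "i \<le> lo - M + p" "tm i \<noteq> tm (i + p)"
      using tm_overlap_free[of p "lo - M"] p by auto
    have "a \<le> M + i" "M + i < a + 2 * p" "i + p < k + 1"
      using i lt by (auto simp: lo_def hi_def)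
    moreover from this have "blocks (k + 1) w (M + i) = blocks (k + 1) w (M + i + p)"
      using ag unfolding agrees_def by simp
    ultimately show False
      using i(3) blocks_add[OF M(1), of i w] blocks_add[OF M(1), of "i + p" w]
      by (simp add: add.assoc) blast
  qed
  then have "hi \<le> lo + p" by simp
  moreover have "M \<le> a + 3" using M by simp
  moreover have "p = 4 \<or> p \<ge> 6" using p by presburger
  moreover have "k = 4 \<or> k \<ge> 8" using k_mod_4 by presburger
  ultimately show False
    using up unfolding lo_def hi_def by linarith
qed

lemma no_short_cube:
  assumes "0 < p" "p \<le> k"
  shows "\<not> agrees (blocks (k + 1) w) p a (2 * p)"
proof -
  consider "p = 1" | "p = 2" | "odd p" "3 \<le> p" | "even p" "4 \<le> p"
    using assms by atomize_elim presburger
  then show ?thesis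
    using no_cube_1[of a] no_cube_2[of a] no_cube_odd[of p a] no_cube_even[of p a] assms(2)
    by cases simp_all
qed

end


section \<open>Repetitions and cubefreeness\<close>

text \<open>Finite and infinite words are treated alike: a factor is given by its position and its
  length, and \<open>fits\<close> says that a word is long enough to contain it.\<close>

fun letter :: "'a word \<Rightarrow> nat \<Rightarrow> 'a" where
  "letter (Fin w) = (!) w"
| "letter (Inf s) = (!!) s"

fun fits :: "'a word \<Rightarrow> nat \<Rightarrow> bool" where
  "fits (Fin w) m \<longleftrightarrow> m \<le> length w"
| "fits (Inf s) m \<longleftrightarrow> True"

definition repetition :: "'a word \<Rightarrow> nat \<Rightarrow> nat \<Rightarrow> nat \<Rightarrow> bool" where
  "repetition z a n p \<longleftrightarrow> fits z (a + n) \<and> 1 \<le> p \<and> p \<le> n \<and>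
     (\<forall>i\<ge>a. i + p < a + n \<longrightarrow> letter z i = letter z (i + p))"

lemma fits_mono: "fits z m \<Longrightarrow> m' \<le> m \<Longrightarrow> fits z m'"
  by (cases z) auto

lemma factors_eq: "factors z = {map (letter z) [a..<a + n] | a n. fits z (a + n)}"
proof (cases z)
  case (Fin w)
  have eq: "map ((!) w) [a..<a + n] = take n (drop a w)" if "a + n \<le> length w" for a n
    using that by (intro nth_equalityI) auto
  have "sublist x w \<longleftrightarrow> (\<exists>a n. x = map ((!) w) [a..<a + n] \<and> a + n \<le> length w)" for x
  proof
    assume "sublist x w"
    then obtain u v where "w = u @ x @ v" by (auto simp: sublist_def)
    then have "x = take (length x) (drop (length u) w)" "length u + length x \<le> length w" by auto
    then show "\<exists>a n. x = map ((!) w) [a..<a + n] \<and> a + n \<le> length w" using eq by metis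
  next
    assume "\<exists>a n. x = map ((!) w) [a..<a + n] \<and> a + n \<le> length w"
    then obtain a n where "x = take n (drop a w)" using eq by auto
    then show "sublist x w" by (metis sublist_drop sublist_order.order.trans sublist_take)
  qed
  then show ?thesis using Fin by auto
next
  case (Inf s)
  have "stake n (sdrop a s) = map ((!!) s) [a..<a + n]" for a n
    by (intro nth_equalityI) (auto simp: sdrop_snth add.commute)
  then show ?thesis using Inf by auto
qed

lemma is_period_factor:
  "is_period (map (letter z) [a..<a + n]) p \<longleftrightarrow>
    1 \<le> p \<and> p \<le> n \<and> (\<forall>i\<ge>a. i + p < a + n \<longrightarrow> letter z i = letter z (i + p))"
proof (cases "p \<le> n")
  case True
  have "(\<forall>i<n - p. letter z (a + i) = letter z (a + (i + p))) \<longleftrightarrow>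
    (\<forall>i\<ge>a. i + p < a + n \<longrightarrow> letter z i = letter z (i + p))" (is "?L \<longleftrightarrow> ?R")
  proof
    assume L: ?L
    show ?R
    proof (intro allI impI)
      fix i assume "a \<le> i" "i + p < a + n"
      then show "letter z i = letter z (i + p)" using L[rule_format, of "i - a"] by simp
    qed
  next
    assume R: ?R
    show ?L
    proof (intro allI impI)
      fix i assume "i < n - p"
      then show "letter z (a + i) = letter z (a + (i + p))"
        using R[rule_format, of "a + i"] by (simp add: add.assoc)
    qed
  qed
  then show ?thesis using True by (simp add: is_period_def)
qed (simp add: is_period_def)

lemma is_period_per: "y \<noteq> [] \<Longrightarrow> is_period y (per y)"
  unfolding per_def by (rule LeastI[of _ "length y"]) (simp add: is_period_def Suc_le_eq)

text \<open>The least period of a factor is replaced by an arbitrary one, which is harmless since the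
  inequality for the least period implies it for every larger one. Cubefreeness, a strict bound on
  a supremum, requires a single constant below 3 for all repetitions.\<close>

lemma cubefree_iff:
  "cubefree z \<longleftrightarrow> (\<exists>C<3. \<forall>a n p. repetition z a n p \<longrightarrow> real n \<le> C * real p)"
proof
  assume "cubefree z"
  then obtain C where C: "cexp z < ereal C" "ereal C < 3"
    using ereal_dense2 unfolding cubefree_def by blast
  have "real n \<le> C * real p" if rep: "repetition z a n p" for a n p
  proof -
    let ?y = "map (letter z) [a..<a + n]"
    have y: "?y \<in> factors z" "?y \<noteq> []" and per: "is_period ?y p"
      using rep by (auto simp: repetition_def factors_eq is_period_factor)
    have "per ?y \<le> p" unfolding per_def using per by (rule Least_le)
    moreover have "1 \<le> per ?y" using is_period_per[OF y(2)] by (simp only: is_period_def)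
    ultimately have "real n / real p \<le> expo ?y"
      unfolding expo_def by (simp add: frac_le)
    also have "ereal (expo ?y) \<le> cexp z"
      unfolding cexp_def using y by (intro SUP_upper) auto
    then have "expo ?y \<le> C" using C(1) by (metis ereal_less_eq(3) le_less_trans less_imp_le)
    finally show ?thesis using rep by (simp add: repetition_def divide_le_eq)
  qed
  moreover have "C < 3" using C(2) by simp
  ultimately show "\<exists>C<3. \<forall>a n p. repetition z a n p \<longrightarrow> real n \<le> C * real p" by blast
next
  assume "\<exists>C<3. \<forall>a n p. repetition z a n p \<longrightarrow> real n \<le> C * real p"
  then obtain C where C: "C < 3" "\<And>a n p. repetition z a n p \<Longrightarrow> real n \<le> C * real p" by blast
  have "expo y \<le> C" if y: "y \<in> factors z" "y \<noteq> []" for y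
  proof -
    obtain a n where an: "y = map (letter z) [a..<a + n]" "fits z (a + n)"
      using y(1) unfolding factors_eq by blast
    have "is_period y (per y)" using y(2) by (rule is_period_per)
    then have "repetition z a n (per y)" "1 \<le> per y"
      using an is_period_factor[of z a n "per y"] by (auto simp: repetition_def)
    then show ?thesis using C(2)[of a n "per y"] an(1) by (simp add: expo_def divide_le_eq)
  qed
  then have "cexp z \<le> ereal C" unfolding cexp_def by (intro SUP_least) auto
  also have "\<dots> < 3" using C(1) by simp
  finally show "cubefree z" unfolding cubefree_def .
qed


section \<open>Images under the block morphisms\<close>

lemma length_h [simp]: "length (h K c) = K"
  by (simp add: h_def complement_def)

lemma h_nth: "i < K \<Longrightarrow> h K c ! i \<longleftrightarrow> c \<noteq> tm i"
  by (simp add: h_def complement_def)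

lemma concat_map_nth:
  assumes "\<And>x. length (f x) = K" "i < K * length w"
  shows "concat (map f w) ! i = f (w ! (i div K)) ! (i mod K)"
  using assms(2)
proof (induction w arbitrary: i)
  case (Cons x w)
  then have "K > 0" by (cases K) auto
  then show ?case
    using Cons assms(1) by (cases "i < K") (auto simp: nth_append le_div_geq le_mod_geq)
qed simp

lemma length_concat_map: "(\<And>x. length (f x) = K) \<Longrightarrow> length (concat (map f w)) = K * length w"
  by (induction w) auto

lemma flat_smap_nth:
  assumes "\<And>x. length (f x) = K" "K > 0"
  shows "flat (smap f s) !! i = f (s !! (i div K)) ! (i mod K)"
proof (induction i arbitrary: s rule: less_induct)
  case (less i)
  have "flat (smap f s) = f (shd s) @- flat (smap f (stl s))"
    using assms flat_unfold[of "smap f s"] by (metis length_greater_0_conv stream.map_sel)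
  then show ?case
    using less[of "i - K" "stl s"] assms
    by (cases "i < K") (auto simp: shift_snth le_div_geq le_mod_geq)
qed

lemma fits_apply_h: "K > 0 \<Longrightarrow> fits (apply_morphism (h K) z) (Suc i) \<longleftrightarrow> fits z (Suc (i div K))"
  by (cases z) (auto simp: length_concat_map[of _ K] Suc_le_eq div_less_iff_less_mult mult.commute)

lemma letter_apply_h:
  assumes "K > 0" "fits (apply_morphism (h K) z) (Suc i)"
  shows "letter (apply_morphism (h K) z) i \<longleftrightarrow> blocks K (letter z) i"
  using assms
  by (cases z) (simp_all add: length_concat_map[of _ K] concat_map_nth[of _ K] flat_smap_nth[of _ K]
      blocks_def h_nth Suc_le_eq)

lemma word_eqI:
  assumes fits: "\<And>i. fits z (Suc i) \<longleftrightarrow> fits z' (Suc i)"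
    and letter: "\<And>i. fits z (Suc i) \<Longrightarrow> letter z i = letter z' i"
  shows "z = z'"
proof (cases z)
  case (Fin w)
  then obtain w' where w': "z' = Fin w'" using fits[of "length w"] by (cases z') auto
  have "length w = length w'"
    using fits Fin w' by (metis fits.simps(1) Suc_le_eq linorder_neqE_nat less_irrefl)
  then show ?thesis using letter Fin w' by (auto intro!: nth_equalityI)
next
  case (Inf s)
  have "\<nexists>w'. z' = Fin w'"
  proof
    assume "\<exists>w'. z' = Fin w'"
    then obtain w' where "z' = Fin w'" by blast
    then show False using fits[of "length w'"] Inf by simp
  qed
  then obtain s' where s': "z' = Inf s'" by (cases z') auto
  then show ?thesis using letter Inf by (auto intro!: stream_eqI)
qed

lemma blocks_1: "blocks 1 w = w"
  using tm_0 by (auto simp: blocks_def)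

text \<open>The last binary digit of \<open>i mod (2 * K)\<close> is that of \<open>i\<close>, and removing it leaves \<open>(i div 2)
  mod K\<close>; each digit one of a position complements the letter of the Thue--Morse word.\<close>

lemma blocks_blocks_2: "blocks 2 (blocks K w) = blocks (2 * K) w"
proof
  fix i
  have "tm (i mod (2 * K)) \<longleftrightarrow> tm (i div 2 mod K) \<noteq> tm (i mod 2)"
    using tm_even[of "i div 2 mod K"] tm_odd[of "i div 2 mod K"] tm_0 tm_odd[of 0]
    by (cases "even i") (simp_all add: mod_mult2_eq even_iff_mod_2_eq_zero odd_iff_mod_2_eq_one
        del: snth.simps)
  then show "blocks 2 (blocks K w) i = blocks (2 * K) w i"
    by (auto simp: blocks_def div_mult2_eq)
qed

lemma apply_h_1: "apply_morphism (h 1) z = z"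
proof (rule word_eqI)
  show "letter (apply_morphism (h 1) z) i = letter z i"
    if "fits (apply_morphism (h 1) z) (Suc i)" for i
    using letter_apply_h[OF _ that] blocks_1 by simp
qed (simp add: fits_apply_h[of 1, simplified])

lemma apply_h_double:
  assumes "K > 0"
  shows "apply_morphism (h (2 * K)) z = apply_morphism (h 2) (apply_morphism (h K) z)"
proof (rule word_eqI)
  fix i
  show fits: "fits (apply_morphism (h (2 * K)) z) (Suc i) \<longleftrightarrow>
      fits (apply_morphism (h 2) (apply_morphism (h K) z)) (Suc i)"
    using assms by (simp add: fits_apply_h div_mult2_eq)
  assume *: "fits (apply_morphism (h (2 * K)) z) (Suc i)"
  then have "fits (apply_morphism (h K) z) (Suc (i div 2))"
    using assms by (simp add: fits_apply_h div_mult2_eq)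
  then have "blocks 2 (letter (apply_morphism (h K) z)) i = blocks 2 (blocks K (letter z)) i"
    using letter_apply_h[OF assms] by (simp add: blocks_def)
  then show "letter (apply_morphism (h (2 * K)) z) i =
      letter (apply_morphism (h 2) (apply_morphism (h K) z)) i"
    using letter_apply_h[OF _ *] letter_apply_h[of 2 "apply_morphism (h K) z" i] fits * assms
    by (simp add: blocks_blocks_2)
qed

lemma repetition_apply_h:
  assumes K: "K > 0" and rep: "repetition z a n p"
  shows "repetition (apply_morphism (h K) z) (K * a) (K * n) (K * p)"
proof -
  let ?z = "apply_morphism (h K) z"
  have n: "n > 0" using rep by (auto simp: repetition_def)
  have "(K * (a + n) - 1) div K < a + n" using K n by (simp add: div_less_iff_less_mult mult.commute)
  then have "fits ?z (Suc (K * (a + n) - 1))"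
    unfolding fits_apply_h[OF K] using rep by (auto simp: repetition_def intro: fits_mono)
  then have fits: "fits ?z (K * a + K * n)" using K n by (simp add: algebra_simps)
  moreover have "letter ?z i = letter ?z (i + K * p)"
    if i: "K * a \<le> i" "i + K * p < K * a + K * n" for i
  proof -
    have "letter ?z i = blocks K (letter z) i" "letter ?z (i + K * p) = blocks K (letter z) (i + K * p)"
      using i fits by (auto intro!: letter_apply_h[OF K] intro: fits_mono)
    moreover have "a \<le> i div K" using i(1) K by (simp add: less_eq_div_iff_mult_less_eq mult.commute)
    moreover have "(i + K * p) div K < a + n"
      using i(2) K by (simp add: div_less_iff_less_mult algebra_simps del: div_mult_self2)
    then have "i div K + p < a + n" using K by simp
    moreover from this \<open>a \<le> i div K\<close> have "letter z (i div K) = letter z (i div K + p)"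
      using rep by (simp add: repetition_def)
    ultimately show ?thesis using K by (simp add: blocks_def add.commute)
  qed
  ultimately show ?thesis using rep K by (auto simp: repetition_def)
qed

text \<open>Since the two blocks are complementary, the letter of \<open>z\<close> belonging to a block can be read
  off at any position of the block. Two letters of \<open>z\<close> at distance \<open>q\<close> therefore agree as soon as
  the repetition contains one position of the first block together with its shift by \<open>K * q\<close>. This
  is so for any two blocks at distance \<open>q\<close> that it meets, even partial ones at the ends. The
  condition \<open>K * q < n\<close> matters: for \<open>K * q = n\<close> there is no comparison at all in the image, while
  the blocks that it meets may be one too many for a factor of length \<open>q\<close>.\<close>

lemma repetition_descend:
  assumes K: "K > 0" and rep: "repetition (apply_morphism (h K) z) a n (K * q)" and q: "K * q < n"
  shows "\<exists>a' n'. repetition z a' n' q \<and> n \<le> K * n'"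
proof -
  let ?z = "apply_morphism (h K) z"
  define b where "b = (a + n - 1) div K"
  define a' where "a' = a div K"
  define n' where "n' = Suc b - a'"
  have div: "K * (m div K) \<le> m" "m < K * (m div K) + K" for m
    using K mult_div_mod_eq[of K m] mod_less_divisor[of K m] by linarith+
  have bK: "a + n \<le> K * b + K" "K * b \<le> a + n - 1" "K * a' \<le> a" "a < K * a' + K"
    using div[of "a + n - 1"] div[of a] q unfolding b_def a'_def by linarith+
  have ab: "a' \<le> b" unfolding a'_def b_def using q by (intro div_le_mono) simp
  have fits_an: "fits ?z (a + n)" using rep by (simp add: repetition_def)
  have "a' + n' = Suc b" using ab by (simp add: n'_def)
  moreover have "fits z (Suc b)"
    unfolding b_def fits_apply_h[OF K, symmetric] using fits_an q by simp
  moreover have nK: "n \<le> K * n'"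
  proof -
    have "K * a' + K * n' = K * b + K" using \<open>a' + n' = Suc b\<close> by (metis distrib_left mult_Suc_right add.commute)
    then show ?thesis using bK by linarith
  qed
  moreover have "q \<le> n'" using nK q K by (metis less_le_trans mult_less_cancel1 less_imp_le)
  moreover have "letter z c = letter z (c + q)" if c: "a' \<le> c" "c + q < a' + n'" for c
  proof -
    (* the first position of the repetition that lies in the block of c *)
    define i where "i = max a (K * c)"
    have "K * (c + q) \<le> K * b" using c \<open>a' + n' = Suc b\<close> by simp
    then have "K * c + K * q \<le> a + n - 1" using bK by (simp add: distrib_left)
    then have i: "a \<le> i" "i + K * q < a + n" using q by (auto simp: i_def)
    have "K * a' \<le> K * c" using c by simp
    then have "K * c \<le> i" "i < K * c + K" using bK unfolding i_def by linarith+
    then have ic: "i div K = c" using K by (intro div_nat_eqI) (auto simp: algebra_simps)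
    have "blocks K (letter z) i = blocks K (letter z) (i + K * q)"
      using rep i letter_apply_h[OF K, of z i] letter_apply_h[OF K, of z "i + K * q"]
        fits_mono[OF fits_an, of "Suc i"] fits_mono[OF fits_an, of "Suc (i + K * q)"]
      by (simp add: repetition_def)
    then show ?thesis using K ic by (simp add: blocks_def add.commute) blast
  qed
  ultimately have "repetition z a' n' q" using rep K by (auto simp: repetition_def)
  then show ?thesis using nK by blast
qed

lemma cubefree_of_apply_h:
  assumes "K > 0" "cubefree (apply_morphism (h K) z)"
  shows "cubefree z"
proof -
  obtain C where C: "C < 3"
    "\<And>a n p. repetition (apply_morphism (h K) z) a n p \<Longrightarrow> real n \<le> C * real p"
    using assms(2) unfolding cubefree_iff by blast
  have "real n \<le> C * real p" if "repetition z a n p" for a n p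
    using C(2)[OF repetition_apply_h[OF assms(1) that]] assms(1) by (simp add: mult.left_commute)
  then show ?thesis using C(1) unfolding cubefree_iff by blast
qed

text \<open>The repetitions whose period is a multiple of \<open>K\<close> inherit the bound of the original word, so
  only the others must be bounded away from 3. Any uniform bound would do; \<open>3 - 1/K\<close> comes from
  length at most \<open>3 * p - 1\<close> for a period \<open>p \<le> K\<close>.\<close>

lemma cubefree_morphism_h:
  assumes K: "K > 0"
    and unaligned: "\<And>w p a L. \<not> K dvd p \<Longrightarrow> agrees (blocks K w) p a L \<Longrightarrow>
      real (L + p) \<le> (3 - 1 / real K) * real p"
  shows "cubefree_morphism (h K)"
  unfolding cubefree_morphism_def
proof (intro allI impI)
  fix z :: "bool word"
  let ?z = "apply_morphism (h K) z"
  assume "cubefree z"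
  then obtain C where C: "C < 3" "\<And>a n p. repetition z a n p \<Longrightarrow> real n \<le> C * real p"
    unfolding cubefree_iff by blast
  define D where "D = max C (3 - 1 / real K)"
  have "D < 3" using C(1) K by (simp add: D_def)
  moreover have "real n \<le> D * real p" if rep: "repetition ?z a n p" for a n p
  proof (cases "K dvd p")
    case False
    have "agrees (blocks K (letter z)) p a (n - p)"
      unfolding agrees_def
    proof (intro allI impI)
      fix i assume i: "a \<le> i \<and> i < a + (n - p)"
      then have ip: "i + p < a + n" by linarith
      then have "letter ?z i = letter ?z (i + p)" using rep i by (simp add: repetition_def)
      moreover have "fits ?z (Suc i)" "fits ?z (Suc (i + p))"
        using rep ip by (auto simp: repetition_def intro: fits_mono[of _ "a + n"])
      ultimately show "blocks K (letter z) i = blocks K (letter z) (i + p)"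
        by (simp add: letter_apply_h[OF K])
    qed
    then have "real (n - p + p) \<le> (3 - 1 / real K) * real p" by (rule unaligned[OF False])
    also have "\<dots> \<le> D * real p" by (intro mult_right_mono) (auto simp: D_def)
    finally show ?thesis using rep by (simp add: repetition_def)
  next
    case True
    then obtain q where q: "p = K * q" by blast
    show ?thesis
    proof (cases "p = n")
      case True
      have "1 / real K \<le> 1" using K by simp
      then have "1 \<le> D" unfolding D_def by linarith
      then show ?thesis using True by (simp add: mult_le_cancel_right1)
    next
      case False
      then have "K * q < n" using rep q by (simp add: repetition_def)
      then obtain a' n' where *: "repetition z a' n' q" "n \<le> K * n'"
        using repetition_descend[OF K] rep q by blast
      have "real n \<le> real K * real n'" using *(2) by (metis of_nat_le_iff of_nat_mult)
      also have "\<dots> \<le> real K * (C * real q)" using C(2)[OF *(1)] by (simp add: mult_left_mono)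
      also have "\<dots> = C * real p" using q by simp
      also have "\<dots> \<le> D * real p" by (intro mult_right_mono) (auto simp: D_def)
      finally show ?thesis .
    qed
  qed
  ultimately show "cubefree ?z" unfolding cubefree_iff by blast
qed

text \<open>For an odd period \<open>p\<close>, one of the positions \<open>j\<close> and \<open>j + p\<close> is at the end of a block, which
  has two different letters. If the agreement were longer than \<open>p\<close>, the word would hence alternate
  on it, and its letters at the odd distance \<open>p\<close> would differ.\<close>

lemma cubefree_morphism_h_2: "cubefree_morphism (h 2)"
proof (rule cubefree_morphism_h)
  fix w p a L
  assume "\<not> 2 dvd p" and ag: "agrees (blocks 2 w) p a L"
  then have p: "odd p" by simp
  let ?x = "blocks 2 w"
  have "L \<le> p"
  proof (rule ccontr)
    assume "\<not> L \<le> p"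
    then have eq: "?x i = ?x (i + p)" if "a \<le> i" "i \<le> a + p" for i
      using ag that unfolding agrees_def by simp
    have pair: "?x (j - 1) \<noteq> ?x j" if "odd j" for j
      using that tm_0 tm_odd[of 0] by (auto elim!: oddE simp: blocks_def simp del: snth.simps)
    have step: "?x j \<noteq> ?x (Suc j)" if j: "a \<le> j" "Suc j \<le> a + p" for j
    proof (cases "even j")
      case True
      then show ?thesis using pair[of "Suc j"] by simp
    next
      case False
      then show ?thesis using pair[of "Suc j + p"] p eq[of j] eq[of "Suc j"] j by simp
    qed
    have "?x (a + d) \<longleftrightarrow> ?x a \<noteq> odd d" if "d \<le> p" for d
      using that
    proof (induction d)
      case (Suc d)
      then show ?case using step[of "a + d"] by auto
    qed simp
    from this[of p] show False using p eq[of a] by auto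
  qed
  then show "real (L + p) \<le> (3 - 1 / real 2) * real p" by simp
qed simp

lemma cubefree_morphism_h_double:
  assumes "K > 0"
  shows "cubefree_morphism (h (2 * K)) \<longleftrightarrow> cubefree_morphism (h K)"
  using cubefree_morphism_h_2 cubefree_of_apply_h[of 2]
  unfolding cubefree_morphism_def apply_h_double[OF assms] by (metis zero_less_numeral)

lemma cubefree_morphism_h_Suc_even:
  assumes k: "k > 0" "even k"
  shows "cubefree_morphism (h (k + 1)) \<longleftrightarrow> jump k"
proof
  assume jump: "jump k"
  show "cubefree_morphism (h (k + 1))"
  proof (rule cubefree_morphism_h)
    fix w p a L
    assume p: "\<not> k + 1 dvd p" and ag: "agrees (blocks (k + 1) w) p a L"
    then have p0: "p > 0" by (auto intro: gr0I)
    have less: "L < M" if "\<not> agrees (blocks (k + 1) w) p a M" for M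
      using ag that by (force simp: agrees_def)
    have "real (L + p) + real p / real (k + 1) \<le> 3 * real p"
    proof (cases "p \<le> k")
      case True
      then have "L < 2 * p" using less no_short_cube[OF k jump p0] by blast
      then have "real (L + p) + 1 \<le> 3 * real p" by linarith
      moreover have "real p / real (k + 1) \<le> 1" using True by simp
      ultimately show ?thesis by linarith
    next
      case False
      have "5 \<le> k + 1" using k_mod_4[OF k jump] by simp
      then have "L < 2 * (k + 1)" using less long_agreement_dvd[of "k + 1"] k p by auto
      then have "real L + 1 \<le> 2 * real (k + 1)" by linarith
      then have "real L \<le> (2 - 1 / real (k + 1)) * real (k + 1)" by (simp add: left_diff_distrib)
      also have "\<dots> \<le> (2 - 1 / real (k + 1)) * real p"
        using False by (intro mult_left_mono) (auto simp: field_simps)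
      finally show ?thesis by (simp add: algebra_simps)
    qed
    then show "real (L + p) \<le> (3 - 1 / real (k + 1)) * real p" by (simp add: algebra_simps)
  qed simp
next
  assume cf: "cubefree_morphism (h (k + 1))"
  show "jump k"
  proof (rule ccontr)
    assume "\<not> jump k"
    then have eq: "tm (k - 1) = tm k" by (simp add: jump_def)
    let ?z = "Fin [False, tm k]"
    let ?hz = "apply_morphism (h (k + 1)) ?z"
    have "real n \<le> 2 * real p" if "repetition ?z a n p" for a n p
      using that by (auto simp: repetition_def)
    then have "cubefree ?z" unfolding cubefree_iff by (intro exI[of _ 2]) auto
    then have "cubefree ?hz" using cf unfolding cubefree_morphism_def by blast
    moreover have "repetition ?hz (k - 1) 3 1"
    proof -
      have fits: "fits ?hz (k - 1 + 3)" using k by auto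
      have "letter ?hz i = tm k" if "k - 1 \<le> i" "i < k - 1 + 3" for i
      proof -
        have "fits ?hz (Suc i)" using fits that by (auto intro: fits_mono[of _ "k - 1 + 3"])
        then have "letter ?hz i = blocks (k + 1) (letter ?z) i" by (intro letter_apply_h) simp
        moreover have "i = k - 1 \<or> i = k \<or> i = k + 1" using that k(1) by linarith
        ultimately show ?thesis using eq tm_0 k by (auto simp: blocks_def simp del: snth.simps)
      qed
      then show ?thesis using fits by (auto simp: repetition_def)
    qed
    ultimately show False unfolding cubefree_iff by fastforce
  qed
qed


section \<open>The automaton\<close>

definition run :: "nat \<Rightarrow> state" where
  "run n = foldl A_delta Q0 (base2 n)"

lemma run_0: "run 0 = Q0"
  by (simp add: run_def base2.simps)

lemma run_even: "run (2 * n) = A_delta (run n) False"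
  by (cases "n = 0") (simp_all add: run_def base2.simps[of "2 * n"] base2.simps[of 0])

lemma run_odd: "run (2 * n + 1) = A_delta (run n) True"
  by (simp add: run_def base2.simps[of "Suc (2 * n)"])

text \<open>Reading 0 swaps \<open>Q1\<close> and \<open>Q2\<close>, just as doubling negates \<open>jump\<close>. Reading 1 leads to \<open>Q1\<close> or
  \<open>Q3\<close>, just as \<open>jump\<close> holds at odd numbers, and these two states behave alike when 0 is read.\<close>

lemma run_states:
  assumes "n > 0"
  shows "run n \<noteq> Q0 \<and> (run n = Q2 \<longleftrightarrow> \<not> jump n)"
  using assms
proof (induction n rule: less_induct)
  case (less n)
  show ?case
  proof (cases "even n")
    case True
    then obtain m where m: "n = 2 * m" by blast
    then have "run m \<noteq> Q0 \<and> (run m = Q2 \<longleftrightarrow> \<not> jump m)" using less by simp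
    then show ?thesis using m run_even[of m] jump_double[of m] less.prems by (cases "run m") auto
  next
    case False
    then obtain m where "n = 2 * m + 1" by (elim oddE)
    then show ?thesis using run_odd[of m] jump_odd[OF False] by (cases "run m") auto
  qed
qed

lemma A_accepts_iff: "A_accepts (base2 n) \<longleftrightarrow> run n = Q0 \<or> run n = Q1"
  by (simp add: A_accepts_def run_def)

lemma A_accepts_even:
  assumes "n > 0" "even n"
  shows "A_accepts (base2 n) \<longleftrightarrow> jump n"
proof -
  obtain m where m: "n = 2 * m" using assms by blast
  then show ?thesis
    using run_states[of m] run_even[of m] jump_double[of m] assms
    by (cases "run m") (auto simp: A_accepts_iff)
qed

lemma A_accepts_odd: "A_accepts (base2 (2 * n + 1)) \<longleftrightarrow> A_accepts (base2 n)"
  using run_odd[of n] by (cases "run n") (auto simp: A_accepts_iff)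

theorem theorem22:
  fixes k :: nat
  shows "cubefree_morphism (h (k + 1)) \<longleftrightarrow> A_accepts (base2 k)"
proof (induction k rule: less_induct)
  case (less k)
  consider "k = 0" | "k > 0" "even k" | "odd k" by auto
  then show ?case
  proof cases
    case 1
    then show ?thesis
      using apply_h_1 run_0 by (simp add: cubefree_morphism_def A_accepts_iff)
  next
    case 2
    then show ?thesis using cubefree_morphism_h_Suc_even A_accepts_even by simp
  next
    case 3
    then obtain m where m: "k = 2 * m + 1" by (elim oddE)
    then have "cubefree_morphism (h (k + 1)) \<longleftrightarrow> cubefree_morphism (h (m + 1))"
      using cubefree_morphism_h_double[of "m + 1"] by (simp add: algebra_simps)
    also have "\<dots> \<longleftrightarrow> A_accepts (base2 m)" using less.IH m by simp
    also have "\<dots> \<longleftrightarrow> A_accepts (base2 k)" using A_accepts_odd m by simp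
    finally show ?thesis .
  qed
qed

end
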